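(* Let $1\le t\le k$. Let $n_k$ be a node at depth $k$ of the Collatz possibility graph, with arithmetic sequence $a_1j+b_1$ and index map $\alpha_1j+\beta_1$, and let $n_{k-t}$ be its ancestor at depth $k-t$, with arithmetic sequence $a_2j+b_2$ and index map $\alpha_2j+\beta_2$. For there to be a cycle between $n_k$ and its ancestor $n_{k-t}$ there must exist $x,y\in\mathbb{N}$ such that $$a_1x+b_1=a_2y+b_2,\qquad \alpha_1x+\beta_1=\alpha_2y+\beta_2.$$
   Context: $\mathbb{N}=\{0,1,2,\dots\}$ and $S(a,b)=(ai+b)_{i\in\mathbb{N}}$. The operators $T_1,T_2$ are the index substitutions $T_1:i\mapsto 2j$ (old index $i$ equals $2j$, where $j$ is the new index) and $T_2:i\mapsto 2j+1$; on progressions, $T_1:S(a,b)\mapsto S(2a,b)$ and $T_2:S(a,b)\mapsto S(2a,b+a)$. The compact Collatz step is $n\mapsto n/2$ for $n$ even and $n\mapsto(3n+1)/2$ for $n$ odd. The Collatz possibility graph is the tree with root $S(1,0)$ at depth $0$ (whose term with index $i$ is the seed $n_0=i$) in which each node $S(a,b)$ (here $a$ is always odd) has two children. Each is obtained by applying $T_1$ or $T_2$ (a subsequence extraction, giving a progression all of whose terms have the same parity) and then applying the compact Collatz step to every term; the Collatz step preserves the index. The arithmetic sequence of a node $S(a,b)$ is $aj+b$, $j\in\mathbb{N}$. The index map of a node is the affine map $j\mapsto\alpha j+\beta$ giving the seed $n_0$ that lands on position $j$ of the node, obtained by composing the index substitutions along the path: the root has index map $j\mapsto j$, and if a node has index map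 $\alpha j+\beta$, then its child via $T_1$ has index map $2\alpha j+\beta$ and its child via $T_2$ has index map $2\alpha j+\alpha+\beta$. Thus the seed $\alpha j+\beta$ has value $aj+b$ at the node. A cycle between a node and its ancestor means that the two nodes take on equal value when spawned from the same seed: some seed passing through both nodes has equal values at them. *)

theory Defs
  imports Main
begin

definition S :: "nat \<Rightarrow> nat \<Rightarrow> nat \<Rightarrow> nat" where
  "S a b = (\<lambda>i. a * i + b)"

definition collatz :: "nat \<Rightarrow> nat" where
  "collatz n = (if even n then n div 2 else (3 * n + 1) div 2)"

datatype branch = T1 | T2

text \<open>The old index, in terms of the new index \<open>j\<close>.\<close>

fun old_index :: "branch \<Rightarrow> nat \<Rightarrow> nat" where
  "old_index T1 j = 2 * j"
| "old_index T2 j = 2 * j + 1"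

lemma S_old_index:
  "S a b \<circ> old_index T1 = S (2 * a) b"
  "S a b \<circ> old_index T2 = S (2 * a) (b + a)"
  by (auto simp: S_def fun_eq_iff algebra_simps)

text \<open>
  The possibility graph is a tree, so a node is identified with the path leading to it from
  the root: two nodes carrying the same progression at different places are different nodes.
\<close>

datatype node = Root | Child branch node

primrec depth :: "node \<Rightarrow> nat" where
  "depth Root = 0"
| "depth (Child s v) = Suc (depth v)"

inductive ancestor :: "node \<Rightarrow> node \<Rightarrow> bool" where
  parent: "ancestor v (Child s v)"
| step: "ancestor u v \<Longrightarrow> ancestor u (Child s v)"

text \<open>
  \<open>entry v j\<close> is the term at position \<open>j\<close> of the node \<open>v\<close>, together with the seed it was
  spawned from, as a pair (seed, value).  The seed is merely carried along: only the value is
  changed by the Collatz step.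
\<close>

primrec entry :: "node \<Rightarrow> nat \<Rightarrow> nat \<times> nat" where
  "entry Root = (\<lambda>i. (i, S 1 0 i))"
| "entry (Child s v) = (\<lambda>j. apsnd collatz (entry v (old_index s j)))"

definition node_seq :: "node \<Rightarrow> nat \<Rightarrow> nat" where
  "node_seq v = (\<lambda>j. snd (entry v j))"

text \<open>The coefficients \<open>(\<alpha>, \<beta>)\<close> of the index map \<open>j \<mapsto> \<alpha> j + \<beta>\<close>.\<close>

fun index_map :: "node \<Rightarrow> nat \<times> nat" where
  "index_map Root = (1, 0)"
| "index_map (Child T1 v) = (let (\<alpha>, \<beta>) = index_map v in (2 * \<alpha>, \<beta>))"
| "index_map (Child T2 v) = (let (\<alpha>, \<beta>) = index_map v in (2 * \<alpha>, \<alpha> + \<beta>))"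

definition takes_value :: "node \<Rightarrow> nat \<Rightarrow> nat \<Rightarrow> bool" where
  "takes_value v n0 w \<longleftrightarrow> (\<exists>j. entry v j = (n0, w))"

text \<open>Some seed passing through both nodes has the same value at them.\<close>

definition cycle_between :: "node \<Rightarrow> node \<Rightarrow> bool" where
  "cycle_between v u \<longleftrightarrow> (\<exists>n0 w. takes_value v n0 w \<and> takes_value u n0 w)"

text \<open>
  Consistency checks: the value at a node is the Collatz iterate of the seed, and the terms of
  every node do form an arithmetic progression with odd difference and unique coefficients.
\<close>

lemma entry_iterate: "snd (entry v j) = (collatz ^^ depth v) (fst (entry v j))"
  by (induction v arbitrary: j) (auto simp: S_def)

lemma node_seq_Child: "node_seq (Child s v) = collatz \<circ> (node_seq v \<circ> old_index s)"
  by (simp add: node_seq_def fun_eq_iff)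

lemma collatz_S:
  "collatz \<circ> S (2 * a) b = (if even b then S a (b div 2) else S (3 * a) ((3 * b + 1) div 2))"
proof (cases "even b")
  case True
  then obtain c where "b = 2 * c" ..
  then show ?thesis by (simp add: S_def collatz_def fun_eq_iff)
next
  case False
  then obtain c where "b = 2 * c + 1" by (rule oddE)
  then show ?thesis by (simp add: S_def collatz_def fun_eq_iff)
qed

lemma node_seq_progression: "\<exists>a b. odd a \<and> node_seq v = S a b"
proof (induction v)
  case Root
  then show ?case by (intro exI[of _ 1] exI[of _ 0]) (simp add: node_seq_def S_def)
next
  case (Child s v)
  then obtain a b where ab: "odd a" "node_seq v = S a b" by blast
  obtain c where "node_seq v \<circ> old_index s = S (2 * a) c"
    using ab S_old_index by (cases s) auto
  then have "node_seq (Child s v) =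
      (if even c then S a (c div 2) else S (3 * a) ((3 * c + 1) div 2))"
    by (simp add: node_seq_Child collatz_S)
  then show ?case using ab(1) by (metis even_mult_iff odd_numeral)
qed

lemma S_inject: "S a b = S c d \<longleftrightarrow> a = c \<and> b = d"
proof
  assume eq: "S a b = S c d"
  from fun_cong[OF eq, of 0] fun_cong[OF eq, of 1] show "a = c \<and> b = d"
    by (simp add: S_def)
qed simp

end

theory Submission imports Defs begin

text \<open>
  A cycle provides one seed that sits at some position \<open>x\<close> of the one node and at some position
  \<open>y\<close> of the other, with the same value at both.  These positions are the required solution:
  computing the common seed by the index maps gives the equation in \<open>\<alpha>\<close> and \<open>\<beta>\<close>, and computing the
  common value by the progressions gives the equation in \<open>a\<close> and \<open>b\<close>.  The link between the recursive
  labelling of nodes by entries and their coefficients is \<open>fst_entry_index_map\<close>.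
\<close>

text \<open>
  The Collatz step leaves the seed alone, so a child only substitutes the index of its parent, and
  \<open>\<alpha> (2 j) + \<beta> = (2 \<alpha>) j + \<beta>\<close> and \<open>\<alpha> (2 j + 1) + \<beta> = (2 \<alpha>) j + (\<alpha> + \<beta>)\<close> are the two recursion rules of
  the index map.
\<close>

lemma fst_entry_index_map:
  assumes "index_map v = (\<alpha>, \<beta>)"
  shows "fst (entry v j) = \<alpha> * j + \<beta>"
  using assms
proof (induction v arbitrary: \<alpha> \<beta> j)
  case Root
  then show ?case by simp
next
  case (Child s v)
  obtain \<alpha>' \<beta>' where v: "index_map v = (\<alpha>', \<beta>')" by fastforce
  show ?case
    using Child.prems Child.IH[OF v] v by (cases s) (auto simp: algebra_simps)
qed

lemma entry_eq:
  assumes "node_seq v = S a b" and "index_map v = (\<alpha>, \<beta>)"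
  shows "entry v j = (\<alpha> * j + \<beta>, a * j + b)"
proof -
  have "snd (entry v j) = a * j + b"
    using fun_cong[OF assms(1), of j] by (simp add: node_seq_def S_def)
  then show ?thesis
    using fst_entry_index_map[OF assms(2)] by (simp add: prod_eq_iff)
qed

theorem proposition8p1:
  fixes k t :: nat and n_k n_kt :: node
    and a1 b1 a2 b2 \<alpha>1 \<beta>1 \<alpha>2 \<beta>2 :: nat
  assumes "1 \<le> t" and "t \<le> k"
    and "depth n_k = k"
    and "ancestor n_kt n_k" and "depth n_kt = k - t"
    and "node_seq n_k = S a1 b1" and "index_map n_k = (\<alpha>1, \<beta>1)"
    and "node_seq n_kt = S a2 b2" and "index_map n_kt = (\<alpha>2, \<beta>2)"
    and "cycle_between n_k n_kt"
  shows "\<exists>x y :: nat. a1 * x + b1 = a2 * y + b2 \<and> \<alpha>1 * x + \<beta>1 = \<alpha>2 * y + \<beta>2"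
proof -
  obtain n0 w x y where "entry n_k x = (n0, w)" and "entry n_kt y = (n0, w)"
    using \<open>cycle_between n_k n_kt\<close> by (auto simp: cycle_between_def takes_value_def)
  moreover have "entry n_k x = (\<alpha>1 * x + \<beta>1, a1 * x + b1)"
    using \<open>node_seq n_k = S a1 b1\<close> \<open>index_map n_k = (\<alpha>1, \<beta>1)\<close> by (rule entry_eq)
  moreover have "entry n_kt y = (\<alpha>2 * y + \<beta>2, a2 * y + b2)"
    using \<open>node_seq n_kt = S a2 b2\<close> \<open>index_map n_kt = (\<alpha>2, \<beta>2)\<close> by (rule entry_eq)
  ultimately have "a1 * x + b1 = a2 * y + b2 \<and> \<alpha>1 * x + \<beta>1 = \<alpha>2 * y + \<beta>2" by simp
  then show ?thesis by blast
qed

end
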